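(* Let $\mathcal A=\langle Q,\Sigma,\Delta,\mathcal R\rangle$ be a tagged TA whose language consists of tagged $n$-qubit trees, let $t\in\{1,\dots,n\}$ and $b\in\{\mathrm{true},\mathrm{false}\}$. Let $Q'=\{q'\mid q\in Q\}$ be a disjoint copy of $Q$, let $\Delta'=\{q_0'\xrightarrow{x_j^i}(q_1',q_2')\mid q_0\xrightarrow{x_j^i}(q_1,q_2)\in\Delta\}\cup\{q_0'\xrightarrow{\mathbf 0}()\mid q_0\xrightarrow{c}()\in\Delta\}$ with $\mathbf 0=(0,0,0,0,0)$, and let $\mathsf{Res}(\mathcal A,x_t,b)$ be the TA with states $Q\cup Q'$, alphabet $\Sigma\cup\{\mathbf 0\}$, root states $\mathcal R$, and transitions obtained from $\Delta\cup\Delta'$ by replacing each transition $q\xrightarrow{x_t^i}(q_l,q_r)\in\Delta$ by $q\xrightarrow{x_t^i}(q_l',q_r)$ if $b=\mathrm{true}$ and by $q\xrightarrow{x_t^i}(q_l,q_r')$ if $b=\mathrm{false}$. Then $\mathsf{Res}(\mathcal A,x_t,b)\simeq_{\mathrm{Tag}}\mathcal A$, and \[\mathcal L(\mathsf{Res}(\mathcal A,x_t,b))=\{B_{x_t}\cdot T\mid T\in\mathcal L(\mathcal A)\}\text{ if }b=\mathrm{true},\qquad \{B_{\overline{x_t}}\cdot T\mid T\in\mathcal L(\mathcal A)\}\text{ if }b=\mathrm{false}.\]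
   Context: Tree automata: a TA is $\mathcal A=\langle Q,\Sigma,\Delta,\mathcal R\rangle$ with finite state set $Q$, ranked alphabet $\Sigma$ of binary and constant symbols, root states $\mathcal R\subseteq Q$, and transitions that are internal $q\xrightarrow{f}(q_0,q_1)$ or leaf $q\xrightarrow{c}()$. It is assumed no state has leaf transitions with two different constants. A run on a binary tree labels each node with a state so that each leaf labelled $c$ with state $q$ has $q\xrightarrow{c}()\in\Delta$ and each internal node labelled $f$ with state $q$ and children states $q_0$ (left), $q_1$ (right) has $q\xrightarrow{f}(q_0,q_1)\in\Delta$; accepting if the root state is in $\mathcal R$; $\mathcal L(\mathcal A)$ is the set of trees with an accepting run. Leaf symbols are tuples $(a,b,c,d,k)\in\mathbb Z^5$ representing $(1/\sqrt2)^k(a+b\omega+c\omega^2+d\omega^3)$, $\omega=e^{i\pi/4}$. A tagged TA has binary symbols $x_k^j$ ($k$ the qubit, $j$ a tag) with distinct internal transitions carrying distinct symbols. A tagged $n$-qubit tree is a full binary tree of height $n$ whose internal nodes at depth $k-1$ are labelled by symbols $x_k^j$ and whose leaves are labelled in $\mathbb Z^5$; for $b=b_1\cdots b_n\in\{0,1\}^n$, $T(b)$ is the leaf reached by going at depth $k-1$ left if $b_k=0$ and right if $b_k=1$. $B_{x_t}\cdot T$ is the tree with the same internal labels as $T$ and leaf at $b$ equal to $T(b)$ if $b_t=1$ and $\mathbf 0$ if $b_t=0$; $B_{\overline{x_t}}\cdot T$ is the same with the roles of $b_t=0$ and $b_t=1$ exchanged. $\mathrm{Tag}(T)$ replaces every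 leaf label by a special symbol $\square$. For TAs $\mathcal A,\mathcal B$, $\mathcal B\simeq_{\mathrm{Tag}}\mathcal A$ means there is a bijection $S:\mathcal L(\mathcal A)\to\mathcal L(\mathcal B)$ with $\mathrm{Tag}(S(T))=\mathrm{Tag}(T)$ for all $T\in\mathcal L(\mathcal A)$. *)

theory Defs
  imports Main
begin

section \<open>Binary trees, tree automata and their languages\<close>

datatype ('f, 'c) btree = Leaf 'c | Node 'f "('f, 'c) btree" "('f, 'c) btree"

datatype ('f, 'c) symbol = Binary 'f | Constant 'c

text \<open>
  The internal transition from \<open>q\<close> to \<open>(q0, q1)\<close> reading \<open>f\<close> is \<open>Internal q f q0 q1\<close>,
  the leaf transition from \<open>q\<close> to \<open>()\<close> reading \<open>c\<close> is \<open>Final q c\<close>.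
\<close>

datatype ('q, 'f, 'c) transition = Internal 'q 'f 'q 'q | Final 'q 'c

record ('q, 'f, 'c) tree_automaton =
  states :: "'q set"
  alphabet :: "('f, 'c) symbol set"
  transitions :: "('q, 'f, 'c) transition set"
  roots :: "'q set"

text \<open>
  The last conjunct is the standing assumption that no state has leaf transitions with two
  different constants.
\<close>

definition is_ta :: "('q, 'f, 'c) tree_automaton \<Rightarrow> bool" where
  "is_ta A \<longleftrightarrow>
     finite (states A) \<and>
     roots A \<subseteq> states A \<and>
     (\<forall>q f q0 q1. Internal q f q0 q1 \<in> transitions A \<longrightarrow>
        q \<in> states A \<and> Binary f \<in> alphabet A \<and> q0 \<in> states A \<and> q1 \<in> states A) \<and>
     (\<forall>q c. Final q c \<in> transitions A \<longrightarrow> q \<in> states A \<and> Constant c \<in> alphabet A) \<and>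
     (\<forall>q c d. Final q c \<in> transitions A \<longrightarrow> Final q d \<in> transitions A \<longrightarrow> c = d)"

text \<open>
  Nodes are addressed by their path from the root, \<open>False\<close> (the bit 0) meaning left and
  \<open>True\<close> (the bit 1) meaning right. A labelling of the nodes by states is a function on paths;
  its values on paths that are not nodes of the tree are irrelevant.
\<close>

fun is_run ::
  "('q, 'f, 'c) tree_automaton \<Rightarrow> ('f, 'c) btree \<Rightarrow> (bool list \<Rightarrow> 'q) \<Rightarrow> bool" where
  "is_run A (Leaf c) \<rho> \<longleftrightarrow> Final (\<rho> []) c \<in> transitions A"
| "is_run A (Node f l r) \<rho> \<longleftrightarrow>
     Internal (\<rho> []) f (\<rho> [False]) (\<rho> [True]) \<in> transitions A \<and>
     is_run A l (\<lambda>p. \<rho> (False # p)) \<and>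
     is_run A r (\<lambda>p. \<rho> (True # p))"

definition accepting_run ::
  "('q, 'f, 'c) tree_automaton \<Rightarrow> ('f, 'c) btree \<Rightarrow> (bool list \<Rightarrow> 'q) \<Rightarrow> bool" where
  "accepting_run A T \<rho> \<longleftrightarrow> is_run A T \<rho> \<and> \<rho> [] \<in> roots A"

definition lang :: "('q, 'f, 'c) tree_automaton \<Rightarrow> ('f, 'c) btree set" where
  "lang A = {T. \<exists>\<rho>. accepting_run A T \<rho>}"


section \<open>Tagged trees and tagged automata\<close>

text \<open>
  The tuple \<open>(a, b, c, d, k)\<close> stands for the complex number
  \<open>(1/sqrt 2)^k * (a + b\<omega> + c\<omega>^2 + d\<omega>^3)\<close> with \<open>\<omega> = exp (i\<pi>/4)\<close>.
\<close>

type_synonym amplitude = "int \<times> int \<times> int \<times> int \<times> int"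

definition zero_amp :: amplitude where
  "zero_amp = (0, 0, 0, 0, 0)"

text \<open>The pair \<open>(k, j)\<close> is the symbol of qubit \<open>k\<close> with tag \<open>j\<close>; qubits are numbered from 1.\<close>

type_synonym 'j qsymbol = "nat \<times> 'j"

type_synonym 'j qtree = "('j qsymbol, amplitude) btree"

type_synonym ('q, 'j) qta = "('q, 'j qsymbol, amplitude) tree_automaton"

definition is_tagged_ta :: "('q, 'j) qta \<Rightarrow> bool" where
  "is_tagged_ta A \<longleftrightarrow> is_ta A \<and>
     (\<forall>f q q0 q1 p p0 p1.
        Internal q f q0 q1 \<in> transitions A \<longrightarrow> Internal p f p0 p1 \<in> transitions A \<longrightarrow>
        q = p \<and> q0 = p0 \<and> q1 = p1)"

text \<open>
  \<open>qubit_levels k m T\<close>: \<open>T\<close> is a full binary tree of height \<open>m\<close> whose levels are labelled,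
  from the root downwards, by symbols of the qubits \<open>k, k + 1, \<dots>, k + m - 1\<close>.
\<close>

fun qubit_levels :: "nat \<Rightarrow> nat \<Rightarrow> ('j qsymbol, 'c) btree \<Rightarrow> bool" where
  "qubit_levels k 0 (Leaf c) \<longleftrightarrow> True"
| "qubit_levels k (Suc m) (Node f l r) \<longleftrightarrow>
     fst f = k \<and> qubit_levels (Suc k) m l \<and> qubit_levels (Suc k) m r"
| "qubit_levels k 0 (Node f l r) \<longleftrightarrow> False"
| "qubit_levels k (Suc m) (Leaf c) \<longleftrightarrow> False"

definition is_tagged_qtree :: "nat \<Rightarrow> 'j qtree \<Rightarrow> bool" where
  "is_tagged_qtree n T \<longleftrightarrow> qubit_levels 1 n T"

text \<open>\<open>leaf_at T b\<close> is the leaf label \<open>T(b)\<close>; it is only specified if \<open>b\<close> leads to a leaf of \<open>T\<close>.\<close>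

fun leaf_at :: "('f, 'c) btree \<Rightarrow> bool list \<Rightarrow> 'c" where
  "leaf_at (Leaf c) [] = c"
| "leaf_at (Node f l r) (x # b) = leaf_at (if x then r else l) b"
| "leaf_at (Leaf c) (x # b) = undefined"
| "leaf_at (Node f l r) [] = undefined"

text \<open>\<open>map_leaves g T\<close> replaces the leaf \<open>T(b)\<close> by \<open>g b (T(b))\<close>, for every path \<open>b\<close> to a leaf.\<close>

fun map_leaves :: "(bool list \<Rightarrow> 'c \<Rightarrow> 'd) \<Rightarrow> ('f, 'c) btree \<Rightarrow> ('f, 'd) btree" where
  "map_leaves g (Leaf c) = Leaf (g [] c)"
| "map_leaves g (Node f l r) =
     Node f (map_leaves (\<lambda>b. g (False # b)) l) (map_leaves (\<lambda>b. g (True # b)) r)"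

text \<open>
  The operations \<open>B\<close> for \<open>x_t\<close> and for its negation. List indices start at 0, so the bit
  \<open>b_t\<close> is \<open>b ! (t - 1)\<close>.
\<close>

definition B_pos :: "nat \<Rightarrow> 'j qtree \<Rightarrow> 'j qtree" where
  "B_pos t T = map_leaves (\<lambda>b c. if b ! (t - 1) then c else zero_amp) T"

definition B_neg :: "nat \<Rightarrow> 'j qtree \<Rightarrow> 'j qtree" where
  "B_neg t T = map_leaves (\<lambda>b c. if b ! (t - 1) then zero_amp else c) T"

text \<open>The special leaf symbol of tag trees is the element \<open>()\<close> of the type \<open>unit\<close>.\<close>

definition Tag :: "('f, 'c) btree \<Rightarrow> ('f, unit) btree" where
  "Tag T = map_leaves (\<lambda>_ _. ()) T"

definition tag_equiv ::
  "('p, 'j) qta \<Rightarrow> ('q, 'j) qta \<Rightarrow> bool"  (infix \<open>\<simeq>\<^sub>T\<^sub>a\<^sub>g\<close> 50) where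
  "B \<simeq>\<^sub>T\<^sub>a\<^sub>g A \<longleftrightarrow>
     (\<exists>S. bij_betw S (lang A) (lang B) \<and> (\<forall>T \<in> lang A. Tag (S T) = Tag T))"


section \<open>The restriction construction\<close>

text \<open>
  The disjoint copy of the state set is realised by the sum type: \<open>Inl q\<close> is the state \<open>q\<close>
  itself and \<open>Inr q\<close> its primed copy.
\<close>

fun prime_transition ::
  "('q, 'f, amplitude) transition \<Rightarrow> ('q + 'q, 'f, amplitude) transition" where
  "prime_transition (Internal q f l r) = Internal (Inr q) f (Inr l) (Inr r)"
| "prime_transition (Final q c) = Final (Inr q) zero_amp"

text \<open>
  \<open>redirect t b\<close> embeds the original transitions and performs the replacement of those
  reading a symbol of qubit \<open>t\<close>; the primed transitions are not subject to it.
\<close>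

fun redirect ::
  "nat \<Rightarrow> bool \<Rightarrow> ('q, 'j qsymbol, 'c) transition \<Rightarrow> ('q + 'q, 'j qsymbol, 'c) transition" where
  "redirect t b (Internal q f l r) =
     (if fst f = t then
        (if b then Internal (Inl q) f (Inr l) (Inl r) else Internal (Inl q) f (Inl l) (Inr r))
      else Internal (Inl q) f (Inl l) (Inl r))"
| "redirect t b (Final q c) = Final (Inl q) c"

definition Res :: "('q, 'j) qta \<Rightarrow> nat \<Rightarrow> bool \<Rightarrow> ('q + 'q, 'j) qta" where
  "Res A t b =
     \<lparr> states = Inl ` states A \<union> Inr ` states A,
       alphabet = alphabet A \<union> {Constant zero_amp},
       transitions = redirect t b ` transitions A \<union> prime_transition ` transitions A,
       roots = Inl ` roots A \<rparr>"


section \<open>Basic facts\<close>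

lemma leaf_at_map_leaves:
  assumes "qubit_levels k n T" and "length b = n"
  shows "leaf_at (map_leaves g T) b = g b (leaf_at T b)"
  using assms
proof (induction T arbitrary: k n b g)
  case (Leaf c)
  then show ?case by (cases n) auto
next
  case (Node f l r)
  then obtain m where m: "n = Suc m" by (cases n) auto
  then obtain x b' where "b = x # b'" "length b' = m" using Node.prems by (cases b) auto
  then show ?case using Node m by (cases x) auto
qed

lemma leaf_at_B_pos:
  assumes "is_tagged_qtree n T" and "length b = n"
  shows "leaf_at (B_pos t T) b = (if b ! (t - 1) then leaf_at T b else zero_amp)"
  using assms by (simp add: B_pos_def is_tagged_qtree_def leaf_at_map_leaves)

lemma leaf_at_B_neg:
  assumes "is_tagged_qtree n T" and "length b = n"
  shows "leaf_at (B_neg t T) b = (if b ! (t - 1) then zero_amp else leaf_at T b)"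
  using assms by (simp add: B_neg_def is_tagged_qtree_def leaf_at_map_leaves)

lemma Tag_map_leaves: "Tag (map_leaves g T) = Tag T"
  unfolding Tag_def by (induction T arbitrary: g) auto

lemma Tag_B_pos: "Tag (B_pos t T) = Tag T"
  by (simp add: B_pos_def Tag_map_leaves)

lemma Tag_B_neg: "Tag (B_neg t T) = Tag T"
  by (simp add: B_neg_def Tag_map_leaves)

lemma is_ta_Res:
  assumes "is_ta A"
  shows "is_ta (Res A t b)"
proof -
  have internal: "p \<in> states (Res A t b) \<and> Binary f \<in> alphabet (Res A t b) \<and>
      p0 \<in> states (Res A t b) \<and> p1 \<in> states (Res A t b)"
    if "Internal p f p0 p1 \<in> transitions (Res A t b)" for p f p0 p1
  proof -
    from that obtain tr where tr: "tr \<in> transitions A"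
      "Internal p f p0 p1 = redirect t b tr \<or> Internal p f p0 p1 = prime_transition tr"
      by (auto simp: Res_def)
    then obtain q l r where q: "tr = Internal q f l r" "p \<in> {Inl q, Inr q}"
      "p0 \<in> {Inl l, Inr l}" "p1 \<in> {Inl r, Inr r}"
      by (cases tr) (auto split: if_splits)
    have "q \<in> states A \<and> Binary f \<in> alphabet A \<and> l \<in> states A \<and> r \<in> states A"
      using assms tr(1) unfolding q(1) is_ta_def by blast
    then show ?thesis using q by (auto simp: Res_def)
  qed
  have final: "(\<exists>q. p = Inl q \<and> Final q c \<in> transitions A) \<or>
      (\<exists>q d. p = Inr q \<and> c = zero_amp \<and> Final q d \<in> transitions A)"
    if "Final p c \<in> transitions (Res A t b)" for p c
  proof -
    from that obtain tr where tr: "tr \<in> transitions A"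
      "Final p c = redirect t b tr \<or> Final p c = prime_transition tr"
      by (auto simp: Res_def)
    then show ?thesis by (cases tr) (auto split: if_splits)
  qed
  have leafA: "q \<in> states A" "Constant c \<in> alphabet A" if "Final q c \<in> transitions A" for q c
    using assms that unfolding is_ta_def by blast+
  have uniqueA: "c = d" if "Final q c \<in> transitions A" "Final q d \<in> transitions A" for q c d
    using assms that unfolding is_ta_def by blast
  have "p \<in> states (Res A t b) \<and> Constant c \<in> alphabet (Res A t b)"
    if "Final p c \<in> transitions (Res A t b)" for p c
    using final[OF that]
  proof (elim disjE exE conjE)
    fix q assume "p = Inl q" "Final q c \<in> transitions A"
    then show ?thesis using leafA[of q c] by (simp add: Res_def)
  next
    fix q d assume "p = Inr q" "c = zero_amp" "Final q d \<in> transitions A"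
    then show ?thesis using leafA[of q d] by (simp add: Res_def)
  qed
  moreover have "c = d"
    if "Final p c \<in> transitions (Res A t b)" "Final p d \<in> transitions (Res A t b)" for p c d
    using final[OF that(1)] final[OF that(2)] uniqueA by blast
  moreover have "finite (states (Res A t b))" "roots (Res A t b) \<subseteq> states (Res A t b)"
    using assms unfolding is_ta_def Res_def by auto
  ultimately show ?thesis
    using internal unfolding is_ta_def by blast
qed

end

theory Submission
  imports Defs
begin

text \<open>
  Replacing the zeroed leaves of a tree accepted by the restricted automaton by the original
  constants, and forgetting the primes, gives a tree accepted by \<open>A\<close>. Hence the language of the
  restricted automaton is the image of \<open>lang A\<close> under a function \<open>restrict\<close> defined by recursion
  on arbitrary trees; on tagged qubit trees \<open>restrict\<close> is the operation \<open>B\<close>. In a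
  tagged automaton the symbol of a node determines the states of its children, and a state
  determines its leaf constant, so a tree of positive height in \<open>lang A\<close> is determined by its tag;
  since \<open>restrict\<close> preserves tags, it is injective on \<open>lang A\<close>.
\<close>

text \<open>Runs are functions on paths, so combining runs of two subtrees requires gluing. Choosing
  the child states node by node instead makes inductions on trees free of paths.\<close>

fun accepts_from ::
  "('q, 'f, 'c) tree_automaton \<Rightarrow> 'q \<Rightarrow> ('f, 'c) btree \<Rightarrow> bool" where
  "accepts_from A q (Leaf c) \<longleftrightarrow> Final q c \<in> transitions A"
| "accepts_from A q (Node f l r) \<longleftrightarrow>
     (\<exists>q0 q1. Internal q f q0 q1 \<in> transitions A \<and> accepts_from A q0 l \<and> accepts_from A q1 r)"

lemma accepts_from_iff_run: "accepts_from A q T \<longleftrightarrow> (\<exists>\<rho>. is_run A T \<rho> \<and> \<rho> [] = q)"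
proof (induction T arbitrary: q)
  case (Leaf c)
  then show ?case by auto
next
  case (Node f l r)
  show ?case
  proof
    assume "accepts_from A q (Node f l r)"
    then obtain \<rho>0 \<rho>1 where *: "Internal q f (\<rho>0 []) (\<rho>1 []) \<in> transitions A"
      "is_run A l \<rho>0" "is_run A r \<rho>1"
      using Node.IH by auto
    define \<rho> where
      "\<rho> p = (case p of [] \<Rightarrow> q | x # p' \<Rightarrow> if x then \<rho>1 p' else \<rho>0 p')" for p
    have "is_run A (Node f l r) \<rho> \<and> \<rho> [] = q"
      using * by (simp add: \<rho>_def)
    then show "\<exists>\<rho>. is_run A (Node f l r) \<rho> \<and> \<rho> [] = q" by blast
  next
    assume "\<exists>\<rho>. is_run A (Node f l r) \<rho> \<and> \<rho> [] = q"
    then show "accepts_from A q (Node f l r)"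
      using Node.IH by auto
  qed
qed

lemma lang_eq_accepts_from: "lang A = {T. \<exists>q \<in> roots A. accepts_from A q T}"
  unfolding lang_def accepting_run_def accepts_from_iff_run by blast

lemma in_transitions_Res:
  "tr' \<in> transitions (Res A t b) \<longleftrightarrow>
     (\<exists>tr \<in> transitions A. tr' = redirect t b tr \<or> tr' = prime_transition tr)"
  by (auto simp: Res_def)

text \<open>Only \<open>redirect\<close> yields transitions out of \<open>Inl\<close> states and
  only \<open>prime_transition\<close> those out of \<open>Inr\<close> states, so the kind of the
  source state settles the origin. The conditionals on \<open>p0\<close> and \<open>p1\<close> merge
  all cases of \<open>redirect\<close> into one shape.\<close>

lemma Internal_Inl_in_Res:
  "Internal (Inl q) f p0 p1 \<in> transitions (Res A t b) \<longleftrightarrow>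
     (\<exists>l r. Internal q f l r \<in> transitions A \<and>
        p0 = (if fst f = t \<and> b then Inr l else Inl l) \<and>
        p1 = (if fst f = t \<and> \<not> b then Inr r else Inl r))"
proof -
  have eq: "Internal (Inl q) f p0 p1 = redirect t b tr \<or> Internal (Inl q) f p0 p1 = prime_transition tr
      \<longleftrightarrow> (\<exists>l r. tr = Internal q f l r \<and>
        p0 = (if fst f = t \<and> b then Inr l else Inl l) \<and>
        p1 = (if fst f = t \<and> \<not> b then Inr r else Inl r))" for tr
    by (cases tr) auto
  show ?thesis unfolding in_transitions_Res eq by blast
qed

lemma Internal_Inr_in_Res:
  "Internal (Inr q) f p0 p1 \<in> transitions (Res A t b) \<longleftrightarrow>
     (\<exists>l r. Internal q f l r \<in> transitions A \<and> p0 = Inr l \<and> p1 = Inr r)"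
proof -
  have eq: "Internal (Inr q) f p0 p1 = redirect t b tr \<or> Internal (Inr q) f p0 p1 = prime_transition tr
      \<longleftrightarrow> (\<exists>l r. tr = Internal q f l r \<and> p0 = Inr l \<and> p1 = Inr r)" for tr
    by (cases tr) auto
  show ?thesis unfolding in_transitions_Res eq by blast
qed

lemma Final_Inl_in_Res:
  "Final (Inl q) c \<in> transitions (Res A t b) \<longleftrightarrow> Final q c \<in> transitions A"
proof -
  have eq: "Final (Inl q) c = redirect t b tr \<or> Final (Inl q) c = prime_transition tr
      \<longleftrightarrow> tr = Final q c" for tr
    by (cases tr) auto
  show ?thesis unfolding in_transitions_Res eq by blast
qed

lemma Final_Inr_in_Res:
  "Final (Inr q) c \<in> transitions (Res A t b) \<longleftrightarrow>
     c = zero_amp \<and> (\<exists>d. Final q d \<in> transitions A)"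
proof -
  have eq: "Final (Inr q) c = redirect t b tr \<or> Final (Inr q) c = prime_transition tr
      \<longleftrightarrow> c = zero_amp \<and> (\<exists>d. tr = Final q d)" for tr
    by (cases tr) auto
  show ?thesis unfolding in_transitions_Res eq by blast
qed

abbreviation zero_leaves :: "('f, 'c) btree \<Rightarrow> ('f, amplitude) btree" where
  "zero_leaves \<equiv> map_leaves (\<lambda>_ _. zero_amp)"

text \<open>Mirrors the transitions of \<open>Res\<close>: at a symbol of qubit \<open>t\<close> the
  side entering primed states is zeroed, while the other side recurses, since on an arbitrary tree
  an unprimed state may meet qubit \<open>t\<close> again.\<close>

fun restrict :: "nat \<Rightarrow> bool \<Rightarrow> 'j qtree \<Rightarrow> 'j qtree" where
  "restrict t b (Leaf c) = Leaf c"
| "restrict t b (Node f l r) =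
     Node f (if fst f = t \<and> b then zero_leaves l else restrict t b l)
       (if fst f = t \<and> \<not> b then zero_leaves r else restrict t b r)"

text \<open>Primed states lead only to primed states and read only zero leaves. The original tree is
  quantified because its constants cannot be recovered from \<open>T'\<close>.\<close>

lemma accepts_from_Res_Inr:
  "accepts_from (Res A t b) (Inr q) T' \<longleftrightarrow> (\<exists>T. accepts_from A q T \<and> T' = zero_leaves T)"
proof (induction T' arbitrary: q)
  case (Leaf c)
  have "accepts_from A q T \<and> Leaf c = zero_leaves T \<longleftrightarrow>
      c = zero_amp \<and> (\<exists>d. T = Leaf d \<and> Final q d \<in> transitions A)" for T
    by (cases T) auto
  then show ?case by (auto simp: Final_Inr_in_Res)
next
  case (Node f l r)
  have tree: "accepts_from A q T \<and> Node f l r = zero_leaves T \<longleftrightarrow>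
      (\<exists>l' r' q0 q1. T = Node f l' r' \<and> Internal q f q0 q1 \<in> transitions A \<and>
        accepts_from A q0 l' \<and> l = zero_leaves l' \<and>
        accepts_from A q1 r' \<and> r = zero_leaves r')" for T
    by (cases T) auto
  have run: "accepts_from (Res A t b) (Inr q) (Node f l r) \<longleftrightarrow>
      (\<exists>q0 q1. Internal q f q0 q1 \<in> transitions A \<and>
        accepts_from (Res A t b) (Inr q0) l \<and> accepts_from (Res A t b) (Inr q1) r)"
    unfolding accepts_from.simps Internal_Inr_in_Res by blast
  show ?case
    unfolding run Node.IH tree by blast
qed

text \<open>A child redirected to a primed state is handled by \<open>accepts_from_Res_Inr\<close>,
  any other child by the induction hypothesis.\<close>

lemma accepts_from_Res_Inl:
  "accepts_from (Res A t b) (Inl q) T' \<longleftrightarrow> (\<exists>T. accepts_from A q T \<and> T' = restrict t b T)"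
proof (induction T' arbitrary: q)
  case (Leaf c)
  have "accepts_from A q T \<and> Leaf c = restrict t b T \<longleftrightarrow>
      T = Leaf c \<and> Final q c \<in> transitions A" for T
    by (cases T) auto
  then show ?case by (auto simp: Final_Inl_in_Res)
next
  case (Node f l r)
  have tree: "accepts_from A q T \<and> Node f l r = restrict t b T \<longleftrightarrow>
      (\<exists>l' r' q0 q1. T = Node f l' r' \<and> Internal q f q0 q1 \<in> transitions A \<and>
        accepts_from A q0 l' \<and>
        l = (if fst f = t \<and> b then zero_leaves l' else restrict t b l') \<and>
        accepts_from A q1 r' \<and>
        r = (if fst f = t \<and> \<not> b then zero_leaves r' else restrict t b r'))" for T
    by (cases T) auto
  have left: "accepts_from (Res A t b) (if fst f = t \<and> b then Inr q0 else Inl q0) l \<longleftrightarrow>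
      (\<exists>l'. accepts_from A q0 l' \<and>
        l = (if fst f = t \<and> b then zero_leaves l' else restrict t b l'))" for q0
    by (cases "fst f = t \<and> b") (simp_all only: if_True if_False simp_thms Node.IH accepts_from_Res_Inr)
  have right: "accepts_from (Res A t b) (if fst f = t \<and> \<not> b then Inr q1 else Inl q1) r \<longleftrightarrow>
      (\<exists>r'. accepts_from A q1 r' \<and>
        r = (if fst f = t \<and> \<not> b then zero_leaves r' else restrict t b r'))" for q1
    by (cases "fst f = t \<and> \<not> b") (simp_all only: if_True if_False simp_thms Node.IH accepts_from_Res_Inr)
  have run: "accepts_from (Res A t b) (Inl q) (Node f l r) \<longleftrightarrow>
      (\<exists>q0 q1. Internal q f q0 q1 \<in> transitions A \<and>
        accepts_from (Res A t b) (if fst f = t \<and> b then Inr q0 else Inl q0) l \<and>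
        accepts_from (Res A t b) (if fst f = t \<and> \<not> b then Inr q1 else Inl q1) r)"
    unfolding accepts_from.simps Internal_Inl_in_Res by blast
  show ?case
    unfolding run left right tree by blast
qed

lemma lang_Res: "lang (Res A t b) = restrict t b ` lang A"
proof -
  have "roots (Res A t b) = Inl ` roots A" by (simp add: Res_def)
  then show ?thesis by (auto simp: lang_eq_accepts_from accepts_from_Res_Inl)
qed

lemma map_leaves_id: "map_leaves (\<lambda>_ c. c) T = T"
  by (induction T) auto

text \<open>All symbols of \<open>T\<close> belong to qubits from \<open>k\<close> on, hence beyond
  \<open>t\<close>, so no subtree is ever zeroed.\<close>

lemma restrict_below_level:
  assumes "qubit_levels k m T" and "t < k"
  shows "restrict t b T = T"
  using assms
proof (induction T arbitrary: k m)
  case (Node f l r)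
  then show ?case by (cases m) fastforce+
qed simp

text \<open>The start level \<open>k\<close> is general for the induction: below a root of qubit
  \<open>k\<close>, the bit of qubit \<open>t\<close> has index \<open>t - k\<close> in the path.
  Comparing it with \<open>b\<close> treats both restrictions at once.\<close>

lemma restrict_eq_map_leaves:
  assumes "qubit_levels k m T" and "k \<le> t" and "t < k + m"
  shows "restrict t b T = map_leaves (\<lambda>p c. if p ! (t - k) = b then c else zero_amp) T"
  using assms
proof (induction T arbitrary: k m)
  case (Leaf c)
  then show ?case by (cases m) auto
next
  case (Node f l r)
  then obtain m' where m: "m = Suc m'" by (cases m) auto
  have lev: "fst f = k" "qubit_levels (Suc k) m' l" "qubit_levels (Suc k) m' r"
    using Node.prems m by auto
  show ?case
  proof (cases "t = k")
    case True
    \<comment> \<open>The index is 0, so the first bit decides: one side is zeroed, the other lies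
      below level \<open>t\<close> and is left unchanged.\<close>
    then show ?thesis
      using lev restrict_below_level[of "Suc k" m' _ t b]
      by (cases b) (simp_all add: map_leaves_id)
  next
    case False
    \<comment> \<open>Entering a child drops the first bit and raises the level by one, so the index
      still names the same bit.\<close>
    then have "t - k = Suc (t - Suc k)" and "Suc k \<le> t" "t < Suc k + m'"
      using Node.prems m by auto
    then show ?thesis using False lev Node.IH by simp
  qed
qed

lemma restrict_eq_B:
  assumes "is_tagged_qtree n T" and "t \<in> {1..n}"
  shows "restrict t b T = (if b then B_pos t T else B_neg t T)"
proof -
  have "restrict t b T = map_leaves (\<lambda>p c. if p ! (t - 1) = b then c else zero_amp) T"
    using assms by (intro restrict_eq_map_leaves) (auto simp: is_tagged_qtree_def)
  moreover have "(\<lambda>(p :: bool list) c. if p ! (t - 1) = b then c else zero_amp) =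
      (if b then (\<lambda>p c. if p ! (t - 1) then c else zero_amp)
       else (\<lambda>p c. if p ! (t - 1) then zero_amp else c))"
    by (cases b) (auto intro!: ext)
  ultimately show ?thesis by (cases b) (simp_all only: B_pos_def B_neg_def if_True if_False)
qed

text \<open>Starting both trees in one state \<open>q\<close> drives the induction: a common symbol
  forces common child states, and at a leaf \<open>q\<close> admits only one constant.\<close>

lemma accepts_from_Tag_inj:
  assumes "is_tagged_ta A" and "accepts_from A q T" and "accepts_from A q U" and "Tag T = Tag U"
  shows "T = U"
  using assms(2-)
proof (induction T arbitrary: q U)
  case (Leaf c)
  then obtain d where "U = Leaf d" by (cases U) (auto simp: Tag_def)
  then show ?case
    using Leaf assms(1) unfolding is_tagged_ta_def is_ta_def
    by (metis accepts_from.simps(1))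
next
  case (Node f l r)
  then obtain l' r' where U: "U = Node f l' r'" "Tag l = Tag l'" "Tag r = Tag r'"
    by (cases U) (auto simp: Tag_def)
  obtain q0 q1 where q: "Internal q f q0 q1 \<in> transitions A"
    "accepts_from A q0 l" "accepts_from A q1 r"
    using Node.prems by auto
  obtain p0 p1 where p: "Internal q f p0 p1 \<in> transitions A"
    "accepts_from A p0 l'" "accepts_from A p1 r'"
    using Node.prems U by auto
  have "p0 = q0" "p1 = q1"
    using assms(1) p(1) q(1) unfolding is_tagged_ta_def by blast+
  then show ?case using Node.IH U p q by blast
qed

text \<open>
  Trees of height 0 must be excluded, since their tag does not determine the root state.
\<close>

lemma inj_on_Tag_lang:
  assumes A: "is_tagged_ta A" and qtree: "\<forall>T \<in> lang A. is_tagged_qtree n T" and "0 < n"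
  shows "inj_on Tag (lang A)"
proof (rule inj_onI)
  fix T U assume T: "T \<in> lang A" and U: "U \<in> lang A" and tag: "Tag T = Tag U"
  obtain m where "n = Suc m" using \<open>0 < n\<close> by (cases n) auto
  with qtree T obtain f l r where Tn: "T = Node f l r"
    by (cases T) (auto simp: is_tagged_qtree_def)
  with tag obtain l' r' where Un: "U = Node f l' r'"
    by (cases U) (auto simp: Tag_def)
  obtain q where q: "accepts_from A q T" using T by (auto simp: lang_eq_accepts_from)
  obtain p where p: "accepts_from A p U" using U by (auto simp: lang_eq_accepts_from)
  obtain q0 q1 where "Internal q f q0 q1 \<in> transitions A" using q Tn by auto
  moreover obtain p0 p1 where "Internal p f p0 p1 \<in> transitions A" using p Un by auto
  \<comment> \<open>Distinct transitions carry distinct symbols, so the shared root symbol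
    \<open>f\<close> fixes the root state.\<close>
  ultimately have "q = p" using A unfolding is_tagged_ta_def by blast
  then show "T = U" using accepts_from_Tag_inj[OF A q _ tag] p by simp
qed

theorem theorem6p6:
  fixes A :: "('q, 'j) qta" and n t :: nat and b :: bool
  assumes "is_tagged_ta A"
    and "\<forall>T \<in> lang A. is_tagged_qtree n T"
    and "t \<in> {1..n}"
  shows "Res A t b \<simeq>\<^sub>T\<^sub>a\<^sub>g A \<and>
    lang (Res A t b) =
      (if b then {B_pos t T | T. T \<in> lang A} else {B_neg t T | T. T \<in> lang A})"
proof
  have B: "restrict t b T = (if b then B_pos t T else B_neg t T)" if "T \<in> lang A" for T
    using assms that restrict_eq_B by blast
  then have tag: "Tag (restrict t b T) = Tag T" if "T \<in> lang A" for T
    using that by (simp add: Tag_B_pos Tag_B_neg)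
  \<comment> \<open>The range of \<open>t\<close> supplies \<open>0 < n\<close>.\<close>
  have "inj_on Tag (lang A)"
    using assms by (intro inj_on_Tag_lang) auto
  then have "inj_on (restrict t b) (lang A)"
    using tag by (metis inj_on_def)
  then have "bij_betw (restrict t b) (lang A) (lang (Res A t b))"
    by (simp add: bij_betw_def lang_Res)
  then show "Res A t b \<simeq>\<^sub>T\<^sub>a\<^sub>g A"
    using tag unfolding tag_equiv_def by blast
  show "lang (Res A t b) =
      (if b then {B_pos t T | T. T \<in> lang A} else {B_neg t T | T. T \<in> lang A})"
    unfolding lang_Res using B by (auto simp: image_iff)
qed

end
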